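(* Let $(X,d)$ and $(Y,\mu)$ be metric spaces, let $\mathcal B$ be a bornology on $X$, let $\Gamma$ be a directed set, let $I$ be a non-trivial ideal of $\Gamma$, let $((D_\gamma,u_\gamma))_{\gamma\in\Gamma}$ be a net in $\mathcal P[X,Y]$, and let $(D,u)\in\mathcal P[X,Y]$. Then the condition for every $B\in\mathcal B$ and $\epsilon>0$, $\{\gamma\in\Gamma:\text{ for every nonempty } B_1\subset B,\ u(D\cap B_1)\subset[u_\gamma(D_\gamma\cap B_1^\epsilon)]^\epsilon\}\in\mathbb F(I)$ holds if and only if the condition for every $B\in\mathcal B$ and $\epsilon>0$, $\left\{\gamma\in\Gamma:\ \sup_{z\in D\cap B}\ \inf_{x\in B_d(z,\epsilon)\cap D_\gamma}\mu(u(z),u_\gamma(x))<\epsilon\right\}\in\mathbb F(I)$ holds.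
   Context: A partial map from $(X,d)$ to $(Y,\mu)$ is a pair $(D,u)$ where $D$ is a nonempty closed subset of $X$ and $u:D\to Y$ is a function (not assumed continuous); $\mathcal P[X,Y]$ is the set of all partial maps. A bornology $\mathcal B$ on $X$ is a family of nonempty subsets of $X$ that covers $X$, is closed under finite unions, and is closed under taking nonempty subsets. $B_d(z,\epsilon)$ is the open $d$-ball of center $z$ and radius $\epsilon$. For a subset $A$ of a metric space and $\epsilon>0$, $A^\epsilon$ is the union of the open $\epsilon$-balls centered at points of $A$ (so $\emptyset^\epsilon=\emptyset$). A directed set is a nonempty set $\Gamma$ with a reflexive transitive relation $\ge$ such that any two elements have a common upper bound. An ideal $I$ of $\Gamma$ is a family of subsets of $\Gamma$ containing $\emptyset$ and closed under finite unions and under taking subsets; it is non-trivial if $I\ne\{\emptyset\}$ and $\Gamma\notin I$. $\mathbb F(I)=\{A\subset\Gamma:\Gamma\setminus A\in I\}$ is the associated filter. Suprema and infima are taken in $[0,+\infty]$, so $\inf\emptyset=+\infty$ and $\sup\emptyset=0$. *)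

theory Defs
  imports "HOL-Analysis.Analysis"
begin

text \<open>A function on \<open>D\<close> is represented by its extensional extension, so that the elements of
  \<open>partial_maps\<close> are in bijection with pairs \<open>(D, u)\<close> with \<open>u : D \<rightarrow> Y\<close>.\<close>

definition partial_maps :: "('a::metric_space set \<times> ('a \<Rightarrow> 'b::metric_space)) set" where
  "partial_maps = {(D, u). D \<noteq> {} \<and> closed D \<and> u \<in> D \<rightarrow>\<^sub>E UNIV}"

definition bornology :: "'a set set \<Rightarrow> bool" where
  "bornology \<B> \<longleftrightarrow>
     (\<forall>B\<in>\<B>. B \<noteq> {}) \<and>
     \<Union>\<B> = UNIV \<and>
     (\<forall>B\<in>\<B>. \<forall>C\<in>\<B>. B \<union> C \<in> \<B>) \<and>
     (\<forall>B\<in>\<B>. \<forall>C. C \<subseteq> B \<and> C \<noteq> {} \<longrightarrow> C \<in> \<B>)"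

definition enlargement :: "'a::metric_space set \<Rightarrow> real \<Rightarrow> 'a set" where
  "enlargement A \<epsilon> = (\<Union>a\<in>A. ball a \<epsilon>)"

text \<open>\<open>ge x y\<close> stands for \<open>x \<ge> y\<close>; antisymmetry is not required.\<close>

definition directed_set :: "'i set \<Rightarrow> ('i \<Rightarrow> 'i \<Rightarrow> bool) \<Rightarrow> bool" where
  "directed_set \<Gamma> ge \<longleftrightarrow>
     \<Gamma> \<noteq> {} \<and> reflp_on \<Gamma> ge \<and> transp_on \<Gamma> ge \<and>
     (\<forall>\<alpha>\<in>\<Gamma>. \<forall>\<beta>\<in>\<Gamma>. \<exists>\<gamma>\<in>\<Gamma>. ge \<gamma> \<alpha> \<and> ge \<gamma> \<beta>)"

definition set_ideal :: "'i set \<Rightarrow> 'i set set \<Rightarrow> bool" where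
  "set_ideal \<Gamma> I \<longleftrightarrow>
     I \<subseteq> Pow \<Gamma> \<and>
     {} \<in> I \<and>
     (\<forall>A\<in>I. \<forall>B\<in>I. A \<union> B \<in> I) \<and>
     (\<forall>A\<in>I. \<forall>B. B \<subseteq> A \<longrightarrow> B \<in> I)"

definition nontrivial_ideal :: "'i set \<Rightarrow> 'i set set \<Rightarrow> bool" where
  "nontrivial_ideal \<Gamma> I \<longleftrightarrow> set_ideal \<Gamma> I \<and> I \<noteq> {{}} \<and> \<Gamma> \<notin> I"

definition ideal_filter :: "'i set \<Rightarrow> 'i set set \<Rightarrow> 'i set set" where
  "ideal_filter \<Gamma> I = {A. A \<subseteq> \<Gamma> \<and> \<Gamma> - A \<in> I}"

end

theory Submission
  imports Defs
begin

text \<open>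
  The inclusion condition quantifies over all nonempty \<open>B1 \<subseteq> B\<close>, but its content is
  pointwise: testing it on singletons \<open>B1 = {z}\<close> says that every point \<open>(z, u z)\<close> of the graph
  over \<open>D \<inter> B\<close> has a point \<open>(x, un x)\<close> of the other graph with \<open>dist z x < \<epsilon>\<close> and
  \<open>dist (u z) (un x) < \<epsilon>\<close>, and this pointwise form gives back the inclusion for every \<open>B1\<close>
  (\<open>image_in_enlargement_iff_pointwise\<close>).

  For one index, the inequality \<open>sup inf < \<epsilon>\<close> implies the pointwise form with the same \<open>\<epsilon>\<close>, since
  an infimum below \<open>\<epsilon>\<close> is witnessed by a point (\<open>sup_inf_less_imp_pointwise\<close>). Conversely, the
  pointwise form with \<open>\<epsilon>\<close> only bounds the supremum by \<open>\<epsilon>\<close>, not strictly, so one applies it with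
  \<open>\<epsilon> / 2\<close> (\<open>pointwise_imp_sup_inf_less\<close>). This loss is harmless because both conditions range
  over all \<open>\<epsilon> > 0\<close>, and the sets of indices are compared by inclusion, under which the filter
  of the ideal is closed upwards.
\<close>

lemma ideal_filter_mono:
  assumes "set_ideal \<Gamma> I" "A \<in> ideal_filter \<Gamma> I" "A \<subseteq> C" "C \<subseteq> \<Gamma>"
  shows "C \<in> ideal_filter \<Gamma> I"
proof -
  have "\<Gamma> - A \<in> I" "\<Gamma> - C \<subseteq> \<Gamma> - A"
    using assms by (auto simp: ideal_filter_def)
  then have "\<Gamma> - C \<in> I"
    using assms(1) unfolding set_ideal_def by blast
  then show ?thesis
    using assms(4) by (simp add: ideal_filter_def)
qed

text \<open>
  Enlargement is a union of balls around points, hence commutes with unions; so an inclusion over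
  all subsets of \<open>B\<close> is decided by the singletons.
\<close>

lemma image_in_enlargement_iff_pointwise:
  fixes u :: "'a::metric_space \<Rightarrow> 'b::metric_space"
  shows "(\<forall>B1. B1 \<noteq> {} \<and> B1 \<subseteq> B \<longrightarrow>
            u ` (D \<inter> B1) \<subseteq> enlargement (v ` (E \<inter> enlargement B1 \<epsilon>)) \<delta>)
     \<longleftrightarrow> (\<forall>z\<in>D \<inter> B. \<exists>x\<in>ball z \<epsilon> \<inter> E. dist (u z) (v x) < \<delta>)"
    (is "?incl \<longleftrightarrow> ?ptw")
proof
  assume incl: ?incl
  show ?ptw
  proof
    fix z assume z: "z \<in> D \<inter> B"
    then have "u ` (D \<inter> {z}) \<subseteq> enlargement (v ` (E \<inter> enlargement {z} \<epsilon>)) \<delta>"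
      using incl by blast
    then show "\<exists>x\<in>ball z \<epsilon> \<inter> E. dist (u z) (v x) < \<delta>"
      using z by (force simp: enlargement_def dist_commute)
  qed
next
  assume ptw: ?ptw
  show ?incl
  proof (intro allI impI image_subsetI)
    fix B1 z assume "B1 \<noteq> {} \<and> B1 \<subseteq> B" and z: "z \<in> D \<inter> B1"
    then obtain x where "x \<in> ball z \<epsilon> \<inter> E" "dist (u z) (v x) < \<delta>"
      using ptw by blast
    then show "u z \<in> enlargement (v ` (E \<inter> enlargement B1 \<epsilon>)) \<delta>"
      using z by (force simp: enlargement_def dist_commute)
  qed
qed

lemma sup_inf_less_imp_pointwise:
  fixes u :: "'a::metric_space \<Rightarrow> 'b::metric_space"
  assumes "(SUP z\<in>A. INF x\<in>ball z \<epsilon> \<inter> E. ennreal (dist (u z) (v x))) < ennreal \<epsilon>"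
  shows "\<forall>z\<in>A. \<exists>x\<in>ball z \<epsilon> \<inter> E. dist (u z) (v x) < \<epsilon>"
proof
  fix z assume "z \<in> A"
  then have "(INF x\<in>ball z \<epsilon> \<inter> E. ennreal (dist (u z) (v x))) < ennreal \<epsilon>"
    using assms by (meson SUP_upper le_less_trans)
  then show "\<exists>x\<in>ball z \<epsilon> \<inter> E. dist (u z) (v x) < \<epsilon>"
    by (auto simp: INF_less_iff ennreal_less_iff)
qed

text \<open>
  A supremum of numbers below \<open>\<delta>\<close> may equal \<open>\<delta>\<close>, so a strict bound needs a smaller radius to
  start from. Passing to the larger balls of radius \<open>\<epsilon>\<close> can only decrease the infima.
\<close>

lemma pointwise_imp_sup_inf_less:
  fixes u :: "'a::metric_space \<Rightarrow> 'b::metric_space"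
  assumes "0 < \<epsilon>" "\<delta> < \<epsilon>"
    and ptw: "\<forall>z\<in>A. \<exists>x\<in>ball z \<delta> \<inter> E. dist (u z) (v x) < \<delta>"
  shows "(SUP z\<in>A. INF x\<in>ball z \<epsilon> \<inter> E. ennreal (dist (u z) (v x))) < ennreal \<epsilon>"
proof -
  have "(SUP z\<in>A. INF x\<in>ball z \<epsilon> \<inter> E. ennreal (dist (u z) (v x))) \<le> ennreal \<delta>"
  proof (rule SUP_least)
    fix z assume "z \<in> A"
    then obtain x where x: "x \<in> ball z \<delta> \<inter> E" "dist (u z) (v x) < \<delta>"
      using ptw by blast
    then have "x \<in> ball z \<epsilon> \<inter> E"
      using assms(2) by auto
    then show "(INF x\<in>ball z \<epsilon> \<inter> E. ennreal (dist (u z) (v x))) \<le> ennreal \<delta>"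
      using x(2) by (intro INF_lower2) (auto intro: ennreal_leI)
  qed
  also have "\<dots> < ennreal \<epsilon>"
    using assms(1,2) by (simp add: ennreal_lessI)
  finally show ?thesis .
qed

theorem proposition3p3:
  fixes \<B> :: "'a::metric_space set set"
    and \<Gamma> :: "'i set" and ge :: "'i \<Rightarrow> 'i \<Rightarrow> bool" and I :: "'i set set"
    and Dn :: "'i \<Rightarrow> 'a set" and un :: "'i \<Rightarrow> 'a \<Rightarrow> 'b::metric_space"
    and D :: "'a set" and u :: "'a \<Rightarrow> 'b"
  assumes "bornology \<B>"
    and "directed_set \<Gamma> ge"
    and "nontrivial_ideal \<Gamma> I"
    and "\<forall>\<gamma>\<in>\<Gamma>. (Dn \<gamma>, un \<gamma>) \<in> partial_maps"
    and "(D, u) \<in> partial_maps"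
  shows "(\<forall>B\<in>\<B>. \<forall>\<epsilon>::real. \<epsilon> > 0 \<longrightarrow>
            {\<gamma>\<in>\<Gamma>. \<forall>B1. B1 \<noteq> {} \<and> B1 \<subseteq> B \<longrightarrow>
               u ` (D \<inter> B1) \<subseteq> enlargement (un \<gamma> ` (Dn \<gamma> \<inter> enlargement B1 \<epsilon>)) \<epsilon>}
            \<in> ideal_filter \<Gamma> I)
     \<longleftrightarrow>
         (\<forall>B\<in>\<B>. \<forall>\<epsilon>::real. \<epsilon> > 0 \<longrightarrow>
            {\<gamma>\<in>\<Gamma>. (SUP z\<in>D \<inter> B. INF x\<in>ball z \<epsilon> \<inter> Dn \<gamma>. ennreal (dist (u z) (un \<gamma> x)))
                   < ennreal \<epsilon>}
            \<in> ideal_filter \<Gamma> I)"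
proof -
  have ideal: "set_ideal \<Gamma> I"
    using assms(3) by (simp add: nontrivial_ideal_def)
  show ?thesis
    unfolding image_in_enlargement_iff_pointwise
  proof (intro iffI ballI allI impI)
    fix B and \<epsilon> :: real
    assume ptw: "\<forall>B\<in>\<B>. \<forall>\<epsilon>::real. \<epsilon> > 0 \<longrightarrow>
        {\<gamma>\<in>\<Gamma>. \<forall>z\<in>D \<inter> B. \<exists>x\<in>ball z \<epsilon> \<inter> Dn \<gamma>. dist (u z) (un \<gamma> x) < \<epsilon>} \<in> ideal_filter \<Gamma> I"
      and B: "B \<in> \<B>" and \<epsilon>: "\<epsilon> > 0"
    have half: "0 < \<epsilon> / 2" "\<epsilon> / 2 < \<epsilon>"
      using \<epsilon> by auto
    show "{\<gamma>\<in>\<Gamma>. (SUP z\<in>D \<inter> B. INF x\<in>ball z \<epsilon> \<inter> Dn \<gamma>. ennreal (dist (u z) (un \<gamma> x)))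
        < ennreal \<epsilon>} \<in> ideal_filter \<Gamma> I"
      by (rule ideal_filter_mono[OF ideal ptw[rule_format, OF B half(1)]])
        (use pointwise_imp_sup_inf_less[OF \<epsilon> half(2)] in blast)+
  next
    fix B and \<epsilon> :: real
    assume sup_inf: "\<forall>B\<in>\<B>. \<forall>\<epsilon>::real. \<epsilon> > 0 \<longrightarrow>
        {\<gamma>\<in>\<Gamma>. (SUP z\<in>D \<inter> B. INF x\<in>ball z \<epsilon> \<inter> Dn \<gamma>. ennreal (dist (u z) (un \<gamma> x)))
          < ennreal \<epsilon>} \<in> ideal_filter \<Gamma> I"
      and B: "B \<in> \<B>" and \<epsilon>: "\<epsilon> > 0"
    show "{\<gamma>\<in>\<Gamma>. \<forall>z\<in>D \<inter> B. \<exists>x\<in>ball z \<epsilon> \<inter> Dn \<gamma>. dist (u z) (un \<gamma> x) < \<epsilon>} \<in> ideal_filter \<Gamma> I"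
      by (rule ideal_filter_mono[OF ideal sup_inf[rule_format, OF B \<epsilon>]])
        (use sup_inf_less_imp_pointwise in blast)+
  qed
qed

end
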